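(* Let $n$ be a nonnegative integer and suppose $f_0,\dots,f_n$ are linearly independent (over $\mathbb{C}$) holomorphic functions on a domain $\Omega\subset\mathbb{C}$. Then there is a discrete subset $\mathcal{E}$ of $\Omega$ with the following property: whenever $\lambda_0,\dots,\lambda_n$ are complex numbers with $\sum_{j=0}^n|\lambda_j|>0$, the $n$-deep zeros of the function $\sum_{j=0}^n\lambda_jf_j$ are all contained in $\mathcal{E}$.
   Context: A domain is a nonempty open connected set. A subset of $\Omega$ is called discrete in $\Omega$ if it has no accumulation points in $\Omega$. Given a nonnegative integer $n$, a holomorphic function $f$ on $\Omega$ and a zero $z_0\in\Omega$ of $f$, the zero $z_0$ is called $n$-deep for $f$ if its multiplicity is at least $n+1$. *)

theory Defs
  imports
    "HOL-Complex_Analysis.Complex_Analysis"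
    "HOL-Library.Extended_Nat"
begin

text \<open>
  Linear independence over the complex numbers of \<open>f 0, \<dots>, f n\<close> as a family of functions
  on \<open>\<Omega>\<close>: only the values on \<open>\<Omega>\<close> matter, and repeated members make the family dependent.
\<close>

definition lin_indep_on :: "complex set \<Rightarrow> nat \<Rightarrow> (nat \<Rightarrow> complex \<Rightarrow> complex) \<Rightarrow> bool" where
  "lin_indep_on \<Omega> n f \<longleftrightarrow>
     (\<forall>c :: nat \<Rightarrow> complex. (\<forall>z\<in>\<Omega>. (\<Sum>j\<le>n. c j * f j z) = 0) \<longrightarrow> (\<forall>j\<le>n. c j = 0))"

text \<open>
  The library's \<open>zorder\<close> is unspecified for a function vanishing identically near the point;
  there the multiplicity is infinite. The value is meaningful for \<open>f\<close> holomorphic near \<open>z\<close>.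
\<close>

definition zero_multiplicity :: "(complex \<Rightarrow> complex) \<Rightarrow> complex \<Rightarrow> enat" where
  "zero_multiplicity f z =
     (if \<forall>\<^sub>F w in nhds z. f w = 0 then \<infinity> else enat (nat (zorder f z)))"

definition deep_zero :: "nat \<Rightarrow> (complex \<Rightarrow> complex) \<Rightarrow> complex \<Rightarrow> bool" where
  "deep_zero n f z \<longleftrightarrow> f z = 0 \<and> zero_multiplicity f z \<ge> enat (n + 1)"

end

theory Submission
  imports Defs
begin

text \<open>
  The exceptional set is classically the zero set of the Wronskian of \<open>f 0, \<dots>, f n\<close>. The proof
  below replaces the determinant by an induction on the number of functions that uses only
  Wronskians \<open>W(u, g) = g' u - g u'\<close> of two functions.

  Put \<open>u = f 0\<close>. The functions \<open>W(u, f 1), \<dots>, W(u, f n)\<close> are again linearly independent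
  (\<open>lin_indep_on_wronskian\<close>): a relation between them says that \<open>W(u, G)\<close> vanishes
  for a combination \<open>G\<close> of \<open>f 1, \<dots>, f n\<close>, so that the quotient \<open>G / u\<close> has derivative zero
  and \<open>G\<close> is a multiple of \<open>u\<close>.
  If \<open>g = l 0 * f 0 + \<dots> + l n * f n\<close> vanishes to order \<open>n + 1\<close> at \<open>z\<close>, then \<open>W(u, g)\<close> vanishes
  there to order \<open>n\<close> (\<open>vanishes_to_order_wronskian\<close>). Since \<open>W(u, u) = 0\<close>, it is the combination
  of \<open>W(u, f 1), \<dots>, W(u, f n)\<close> with coefficients \<open>l 1, \<dots>, l n\<close>. Hence either \<open>z\<close> lies in the
  exceptional set of this shorter family, or \<open>l 1 = \<dots> = l n = 0\<close>. In the latter case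
  \<open>g = l 0 * u\<close> with \<open>l 0 \<noteq> 0\<close>, and \<open>z\<close> is a zero of \<open>u\<close>. So the zeros of \<open>u\<close>, which are discrete,
  are all that has to be added in each step.
\<close>

section \<open>Order of vanishing\<close>

text \<open>
  A factorization, in contrast to a condition on \<open>zorder\<close>, covers functions that vanish
  identically near the point, and it can be differentiated directly.
\<close>

definition vanishes_to_order :: "nat \<Rightarrow> (complex \<Rightarrow> complex) \<Rightarrow> complex \<Rightarrow> bool" where
  "vanishes_to_order k g z \<longleftrightarrow>
     (\<exists>h r. r > 0 \<and> h holomorphic_on ball z r \<and> (\<forall>w\<in>ball z r. g w = (w - z) ^ k * h w))"

lemma vanishes_to_order_Suc_imp_zero:
  "vanishes_to_order (Suc k) g z \<Longrightarrow> g z = 0"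
  by (force simp: vanishes_to_order_def)

lemma deep_zero_imp_vanishes_to_order:
  assumes "open S" "z \<in> S" "g holomorphic_on S" "deep_zero n g z"
  shows "vanishes_to_order (Suc n) g z"
proof (cases "\<forall>\<^sub>F w in nhds z. g w = 0")
  case True
  then obtain r where "r > 0" "\<forall>w\<in>ball z r. g w = 0"
    by (auto simp: eventually_nhds_metric dist_commute)
  then show ?thesis
    unfolding vanishes_to_order_def by (intro exI[of _ "\<lambda>_. 0"] exI[of _ r]) auto
next
  case False
  have gz: "g z = 0" and ord: "Suc n \<le> nat (zorder g z)"
    using assms(4) False by (auto simp: deep_zero_def zero_multiplicity_def)
  obtain r0 where r0: "r0 > 0" "ball z r0 \<subseteq> S"
    using assms(1,2) openE by blast
  have hol: "g holomorphic_on ball z r0"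
    using assms(3) r0(2) holomorphic_on_subset by blast
  have "\<exists>w\<in>ball z r0. g w \<noteq> 0"
    using False r0(1) by (force simp: eventually_nhds_metric dist_commute)
  then obtain r where r: "r > 0" "zor_poly g z holomorphic_on cball z r"
    "\<forall>w\<in>cball z r. g w = zor_poly g z w * (w - z) ^ nat (zorder g z)"
    using zorder_exist_zero[of g "ball z r0" z] hol r0(1) by auto
  define m where "m = nat (zorder g z) - Suc n"
  have m: "nat (zorder g z) = Suc n + m"
    using ord by (simp add: m_def)
  show ?thesis
    unfolding vanishes_to_order_def
  proof (intro exI conjI ballI)
    show "r > 0" by fact
    show "(\<lambda>w. (w - z) ^ m * zor_poly g z w) holomorphic_on ball z r"
      using r(2) by (intro holomorphic_intros) (auto intro: holomorphic_on_subset)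
    show "g w = (w - z) ^ Suc n * ((w - z) ^ m * zor_poly g z w)" if "w \<in> ball z r" for w
      using r(3) that by (simp add: m power_add mult_ac)
  qed
qed

section \<open>Wronskians of two functions\<close>

definition wronskian :: "(complex \<Rightarrow> complex) \<Rightarrow> (complex \<Rightarrow> complex) \<Rightarrow> complex \<Rightarrow> complex" where
  "wronskian u g w = deriv g w * u w - g w * deriv u w"

lemma holomorphic_on_wronskian:
  assumes "open S" "u holomorphic_on S" "g holomorphic_on S"
  shows "wronskian u g holomorphic_on S"
  unfolding wronskian_def[abs_def] using assms by (intro holomorphic_intros) auto

lemma wronskian_self: "wronskian u u w = 0"
  by (simp add: wronskian_def)

lemma wronskian_sum:
  assumes "open S" "w \<in> S" "finite A" "\<And>j. j \<in> A \<Longrightarrow> f j holomorphic_on S"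
  shows "wronskian u (\<lambda>w. \<Sum>j\<in>A. c j * f j w) w = (\<Sum>j\<in>A. c j * wronskian u (f j) w)"
proof -
  have "(f j has_field_derivative deriv (f j) w) (at w)" if "j \<in> A" for j
    using assms that holomorphic_derivI by blast
  then have "((\<lambda>w. \<Sum>j\<in>A. c j * f j w) has_field_derivative (\<Sum>j\<in>A. c j * deriv (f j) w)) (at w)"
    by (intro DERIV_sum DERIV_cmult)
  then have "deriv (\<lambda>w. \<Sum>j\<in>A. c j * f j w) w = (\<Sum>j\<in>A. c j * deriv (f j) w)"
    by (rule DERIV_imp_deriv)
  then show ?thesis
    by (simp add: wronskian_def right_diff_distrib sum_subtractf sum_distrib_right mult.assoc)
qed

text \<open>
  Differentiation lowers the order of vanishing by at most one, and multiplication by a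
  holomorphic function does not lower it.
\<close>

lemma vanishes_to_order_wronskian:
  assumes "open S" "z \<in> S" "u holomorphic_on S" "vanishes_to_order (Suc k) g z"
  shows "vanishes_to_order k (wronskian u g) z"
proof -
  obtain h r1 where r1: "r1 > 0" "h holomorphic_on ball z r1"
    "\<And>w. w \<in> ball z r1 \<Longrightarrow> g w = (w - z) ^ Suc k * h w"
    using assms(4) by (auto simp: vanishes_to_order_def)
  obtain r0 where r0: "r0 > 0" "ball z r0 \<subseteq> S"
    using assms(1,2) openE by blast
  define r where "r = min r0 r1"
  define B where "B = ball z r"
  have r: "r > 0" and B: "open B" "B \<subseteq> ball z r1" "B \<subseteq> S"
    using r0 r1 by (auto simp: r_def B_def)
  have hol: "h holomorphic_on B" "u holomorphic_on B"
    using r1(2) assms(3) B holomorphic_on_subset by blast+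
  define q where "q = (\<lambda>w. of_nat (Suc k) * h w * u w + (w - z) * wronskian u h w)"
  have "q holomorphic_on B"
    unfolding q_def using hol B(1) by (intro holomorphic_intros holomorphic_on_wronskian) auto
  moreover have "wronskian u g w = (w - z) ^ k * q w" if w: "w \<in> B" for w
  proof -
    have "(h has_field_derivative deriv h w) (at w)"
      using hol(1) B(1) w holomorphic_derivI by blast
    moreover have "((\<lambda>w. (w - z) ^ Suc k) has_field_derivative of_nat (Suc k) * (w - z) ^ k) (at w)"
      by (auto intro!: derivative_eq_intros simp del: power_Suc)
    ultimately have "((\<lambda>w. (w - z) ^ Suc k * h w) has_field_derivative
        of_nat (Suc k) * (w - z) ^ k * h w + (w - z) ^ Suc k * deriv h w) (at w)"
      by (auto intro: DERIV_cong[OF DERIV_mult] simp del: power_Suc of_nat_Suc)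
    then have "(g has_field_derivative
        of_nat (Suc k) * (w - z) ^ k * h w + (w - z) ^ Suc k * deriv h w) (at w)"
      by (rule has_field_derivative_transform_within_open[of _ _ _ B]) (use B w r1(3) in auto)
    then have "deriv g w = of_nat (Suc k) * (w - z) ^ k * h w + (w - z) ^ Suc k * deriv h w"
      by (rule DERIV_imp_deriv)
    moreover have "g w = (w - z) ^ Suc k * h w"
      using r1(3) B w by blast
    ultimately show ?thesis
      by (simp only: q_def wronskian_def) (simp add: algebra_simps)
  qed
  ultimately show ?thesis
    unfolding vanishes_to_order_def B_def using r by blast
qed

text \<open>
  Near a point where \<open>u\<close> does not vanish, \<open>wronskian u g / u\<^sup>2\<close> is the derivative of \<open>g / u\<close>;
  the proportionality found there spreads over the domain by the identity theorem.
\<close>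

lemma wronskian_eq_zero_imp_multiple:
  assumes "open S" "connected S" "u holomorphic_on S" "g holomorphic_on S"
    and a: "a \<in> S" "u a \<noteq> 0"
    and W: "\<And>w. w \<in> S \<Longrightarrow> wronskian u g w = 0"
  obtains c where "\<And>w. w \<in> S \<Longrightarrow> g w = c * u w"
proof -
  have "open {w \<in> S. u w \<noteq> 0}"
  proof -
    have "open (S \<inter> u -` (- {0}))"
      using assms(1,3) by (intro continuous_open_preimage holomorphic_on_imp_continuous_on) auto
    moreover have "S \<inter> u -` (- {0}) = {w \<in> S. u w \<noteq> 0}" by auto
    ultimately show ?thesis by simp
  qed
  then obtain r where r: "r > 0" "ball a r \<subseteq> {w \<in> S. u w \<noteq> 0}"
    using a openE by blast
  have "((\<lambda>w. g w / u w) has_field_derivative 0) (at w within ball a r)" if w: "w \<in> ball a r" for w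
  proof -
    have wS: "w \<in> S" "u w \<noteq> 0" using r w by auto
    have "(g has_field_derivative deriv g w) (at w)" "(u has_field_derivative deriv u w) (at w)"
      using assms(1,3,4) wS holomorphic_derivI by blast+
    then have "((\<lambda>w. g w / u w) has_field_derivative
        (deriv g w * u w - g w * deriv u w) / (u w * u w)) (at w)"
      using wS(2) by (rule DERIV_divide)
    then show ?thesis
      using W[OF wS(1)] by (simp add: wronskian_def has_field_derivative_at_within)
  qed
  then obtain c where c: "\<And>w. w \<in> ball a r \<Longrightarrow> g w / u w = c"
    using has_field_derivative_zero_constant[of "ball a r" "\<lambda>w. g w / u w"] by auto
  have "g w - c * u w = 0" if "w \<in> S" for w
  proof (rule analytic_continuation_open[of "ball a r" S "\<lambda>w. g w - c * u w" "\<lambda>_. 0"])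
    show "(\<lambda>w. g w - c * u w) holomorphic_on S"
      using assms(3,4) by (intro holomorphic_intros)
    show "g w - c * u w = 0" if "w \<in> ball a r" for w
      using c[OF that] r that by (auto simp: field_simps)
  qed (use assms(1,2) r that in auto)
  then show ?thesis
    by (intro that[of c]) simp
qed

section \<open>Linear independence\<close>

lemma lin_indep_on_nonzero:
  assumes "lin_indep_on \<Omega> n f" "k \<le> n"
  obtains a where "a \<in> \<Omega>" "f k a \<noteq> 0"
proof -
  have sum: "(\<Sum>j\<le>n. (if j = k then 1 else 0) * f j z) = f k z" for z
    using assms(2) by (simp add: if_distrib[of "\<lambda>x. x * _"] cong: if_cong)
  have "\<not> (\<forall>z\<in>\<Omega>. f k z = 0)"
    using assms(1)[unfolded lin_indep_on_def, rule_format, of "\<lambda>j. if j = k then 1 else 0" k] assms(2)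
    by (auto simp: sum)
  then show ?thesis using that by blast
qed

lemma lin_indep_on_wronskian:
  assumes "open \<Omega>" "connected \<Omega>" "\<And>j. j \<le> Suc n \<Longrightarrow> f j holomorphic_on \<Omega>"
    and indep: "lin_indep_on \<Omega> (Suc n) f"
  shows "lin_indep_on \<Omega> n (\<lambda>j. wronskian (f 0) (f (Suc j)))"
  unfolding lin_indep_on_def
proof (intro allI impI)
  fix c :: "nat \<Rightarrow> complex" and j
  assume c: "\<forall>z\<in>\<Omega>. (\<Sum>j\<le>n. c j * wronskian (f 0) (f (Suc j)) z) = 0" and j: "j \<le> n"
  define G where "G = (\<lambda>w. \<Sum>j\<le>n. c j * f (Suc j) w)"
  obtain a where a: "a \<in> \<Omega>" "f 0 a \<noteq> 0"
    using lin_indep_on_nonzero[OF indep] by blast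
  have G: "G holomorphic_on \<Omega>"
    unfolding G_def using assms(3) by (intro holomorphic_intros) auto
  have "wronskian (f 0) G w = 0" if "w \<in> \<Omega>" for w
    unfolding G_def using c assms(1,3) that by (subst wronskian_sum[of \<Omega>]) auto
  then obtain d where d: "\<And>w. w \<in> \<Omega> \<Longrightarrow> G w = d * f 0 w"
    using wronskian_eq_zero_imp_multiple[of \<Omega> "f 0" G a] assms(1-3) G a by blast
  \<comment> \<open>The coefficients of the relation \<open>G - d * f 0 = 0\<close> between the original functions.\<close>
  define c' where "c' = case_nat (- d) c"
  have "\<forall>z\<in>\<Omega>. (\<Sum>j\<le>Suc n. c' j * f j z) = 0"
    using d unfolding sum.atMost_Suc_shift by (simp add: c'_def G_def)
  then have "c' (Suc j) = 0"
    using indep[unfolded lin_indep_on_def, rule_format, of c' "Suc j"] j by simp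
  then show "c j = 0" by (simp add: c'_def)
qed

section \<open>The exceptional set\<close>

lemma zeros_no_limit_point:
  assumes "open S" "connected S" "u holomorphic_on S" "a \<in> S" "u a \<noteq> 0" "z \<in> S"
  shows "\<not> z islimpt {w \<in> S. u w = 0}"
proof
  assume "z islimpt {w \<in> S. u w = 0}"
  then have "u a = 0"
    using analytic_continuation[of u S "{w \<in> S. u w = 0}" z a] assms by blast
  with assms(5) show False ..
qed

text \<open>
  The coefficients are quantified after \<open>E\<close>, so one set must serve all combinations. The
  induction respects this because the functions \<open>F j\<close> do not depend on the coefficients:
  only which of the two parts of \<open>E \<union> Z\<close> contains a given zero does.
\<close>

lemma exceptional_set_vanishes_to_order:
  assumes "open \<Omega>" "connected \<Omega>"
    and "\<And>j. j \<le> n \<Longrightarrow> f j holomorphic_on \<Omega>"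
    and "lin_indep_on \<Omega> n f"
  shows "\<exists>E. E \<subseteq> \<Omega> \<and> (\<forall>z\<in>\<Omega>. \<not> z islimpt E) \<and>
    (\<forall>l z. (\<exists>j\<le>n. l j \<noteq> 0) \<longrightarrow> z \<in> \<Omega> \<longrightarrow>
      vanishes_to_order (Suc n) (\<lambda>w. \<Sum>j\<le>n. l j * f j w) z \<longrightarrow> z \<in> E)"
  using assms
proof (induction n arbitrary: f)
  case 0
  obtain a where a: "a \<in> \<Omega>" "f 0 a \<noteq> 0"
    using lin_indep_on_nonzero[OF 0(4)] by blast
  have f0: "f 0 holomorphic_on \<Omega>"
    using 0(3) by blast
  show ?case
    using zeros_no_limit_point[OF 0(1,2) f0 a]
    by (intro exI[of _ "{w \<in> \<Omega>. f 0 w = 0}"]) (auto dest: vanishes_to_order_Suc_imp_zero)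
next
  case (Suc n)
  define F where "F = (\<lambda>j. wronskian (f 0) (f (Suc j)))"
  have f0: "f 0 holomorphic_on \<Omega>"
    using Suc.prems(3) by blast
  have "F j holomorphic_on \<Omega>" if "j \<le> n" for j
    unfolding F_def using Suc.prems(1,3) that by (intro holomorphic_on_wronskian) auto
  moreover have "lin_indep_on \<Omega> n F"
    unfolding F_def using lin_indep_on_wronskian[OF Suc.prems] .
  ultimately obtain E where E: "E \<subseteq> \<Omega>" "\<forall>z\<in>\<Omega>. \<not> z islimpt E"
    "\<And>l z. \<exists>j\<le>n. l j \<noteq> 0 \<Longrightarrow> z \<in> \<Omega> \<Longrightarrow>
      vanishes_to_order (Suc n) (\<lambda>w. \<Sum>j\<le>n. l j * F j w) z \<Longrightarrow> z \<in> E"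
    using Suc.IH[OF Suc.prems(1,2), of F] by blast
  obtain a where a: "a \<in> \<Omega>" "f 0 a \<noteq> 0"
    using lin_indep_on_nonzero[OF Suc.prems(4)] by blast
  define Z where "Z = {w \<in> \<Omega>. f 0 w = 0}"
  have "z \<in> E \<union> Z"
    if l: "\<exists>j\<le>Suc n. l j \<noteq> 0" and z: "z \<in> \<Omega>"
      and van: "vanishes_to_order (Suc (Suc n)) (\<lambda>w. \<Sum>j\<le>Suc n. l j * f j w) z" for l z
  proof (cases "\<exists>j\<le>n. l (Suc j) \<noteq> 0")
    case True
    have "vanishes_to_order (Suc n) (wronskian (f 0) (\<lambda>w. \<Sum>j\<le>Suc n. l j * f j w)) z"
      using vanishes_to_order_wronskian[OF Suc.prems(1) z f0 van] .
    then obtain h r where h: "r > 0" "h holomorphic_on ball z r"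
      "\<And>w. w \<in> ball z r \<Longrightarrow>
        wronskian (f 0) (\<lambda>w. \<Sum>j\<le>Suc n. l j * f j w) w = (w - z) ^ Suc n * h w"
      by (auto simp: vanishes_to_order_def)
    obtain r0 where r0: "r0 > 0" "ball z r0 \<subseteq> \<Omega>"
      using Suc.prems(1) z openE by blast
    have "(\<Sum>j\<le>n. l (Suc j) * F j w) = (w - z) ^ Suc n * h w"
      if "w \<in> ball z (min r r0)" for w
    proof -
      have w: "w \<in> ball z r" "w \<in> \<Omega>" using that r0 by auto
      have "wronskian (f 0) (\<lambda>w. \<Sum>j\<le>Suc n. l j * f j w) w
          = (\<Sum>j\<le>Suc n. l j * wronskian (f 0) (f j) w)"
        using Suc.prems(1,3) w(2) by (intro wronskian_sum[of \<Omega>]) auto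
      also have "\<dots> = (\<Sum>j\<le>n. l (Suc j) * F j w)"
        unfolding sum.atMost_Suc_shift by (simp add: F_def wronskian_self)
      finally show ?thesis using h(3)[OF w(1)] by simp
    qed
    moreover have "h holomorphic_on ball z (min r r0)"
      using h(2) by (rule holomorphic_on_subset) auto
    ultimately have "vanishes_to_order (Suc n) (\<lambda>w. \<Sum>j\<le>n. l (Suc j) * F j w) z"
      unfolding vanishes_to_order_def using h(1) r0(1) by (metis min_less_iff_conj)
    then show ?thesis
      using E(3)[of "\<lambda>j. l (Suc j)" z] True z by simp
  next
    case False
    then have "l 0 \<noteq> 0"
      using l by (metis Suc_le_mono not0_implies_Suc)
    moreover have "(\<Sum>j\<le>Suc n. l j * f j z) = l 0 * f 0 z"
      unfolding sum.atMost_Suc_shift using False by simp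
    ultimately show ?thesis
      using vanishes_to_order_Suc_imp_zero[OF van] z by (simp add: Z_def)
  qed
  moreover have "\<forall>z\<in>\<Omega>. \<not> z islimpt (E \<union> Z)"
    using E(2) zeros_no_limit_point[OF Suc.prems(1,2) f0 a]
    by (auto simp: islimpt_Un Z_def)
  moreover have "E \<union> Z \<subseteq> \<Omega>"
    using E(1) by (auto simp: Z_def)
  ultimately show ?case by blast
qed

theorem theoremA:
  fixes n :: nat and \<Omega> :: "complex set" and f :: "nat \<Rightarrow> complex \<Rightarrow> complex"
  assumes "\<Omega> \<noteq> {}" and "open \<Omega>" and "connected \<Omega>"
    and "\<And>j. j \<le> n \<Longrightarrow> f j holomorphic_on \<Omega>"
    and "lin_indep_on \<Omega> n f"
  shows "\<exists>E. E \<subseteq> \<Omega> \<and> (\<forall>z\<in>\<Omega>. \<not> z islimpt E) \<and>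
    (\<forall>l :: nat \<Rightarrow> complex. (\<Sum>j\<le>n. cmod (l j)) > 0 \<longrightarrow>
      {z \<in> \<Omega>. deep_zero n (\<lambda>w. \<Sum>j\<le>n. l j * f j w) z} \<subseteq> E)"
proof -
  obtain E where E: "E \<subseteq> \<Omega>" "\<forall>z\<in>\<Omega>. \<not> z islimpt E"
    "\<And>l z. \<exists>j\<le>n. l j \<noteq> 0 \<Longrightarrow> z \<in> \<Omega> \<Longrightarrow>
      vanishes_to_order (Suc n) (\<lambda>w. \<Sum>j\<le>n. l j * f j w) z \<Longrightarrow> z \<in> E"
    using exceptional_set_vanishes_to_order[OF assms(2-5)] by blast
  have "z \<in> E"
    if l: "(\<Sum>j\<le>n. cmod (l j)) > 0" and z: "z \<in> \<Omega>"
      and deep: "deep_zero n (\<lambda>w. \<Sum>j\<le>n. l j * f j w) z" for l z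
  proof -
    have "\<exists>j\<le>n. l j \<noteq> 0"
      using l by (rule contrapos_pp) auto
    moreover have "(\<lambda>w. \<Sum>j\<le>n. l j * f j w) holomorphic_on \<Omega>"
      using assms(4) by (intro holomorphic_intros) auto
    ultimately show ?thesis
      using E(3) z deep_zero_imp_vanishes_to_order[OF assms(2) z _ deep] by blast
  qed
  then show ?thesis
    using E(1,2) by blast
qed

end
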